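(* Let $v_1,\dots,v_n$ be the vertices of the fully connected similarity graph, with path-based similarity matrix $\mathbf{W}=(\widehat w_{ij})$, degrees $d_i$, degree matrix $\mathbf{D}$ and Laplacian $\mathbf{L}=\mathbf{D}-\mathbf{W}$, and let $\mathbf{C}_1,\dots,\mathbf{C}_k$ be a partition of the vertex set into clusters satisfying the following three assumptions: (1) for any two different clusters $\mathbf{C}_i,\mathbf{C}_j$, if $v_r,v_s\in \mathbf{C}_i$ and $v_t\in\mathbf{C}_j$, then $\widehat w_{rs}\ge \max(\widehat w_{rt},\widehat w_{st})$; (2) for every cluster $\mathbf{C}_i$, if $v_r,v_s\in\mathbf{C}_i$, then $\widehat w_{rs}\ge \max\left(\frac{d_r}{n},\frac{d_s}{n}\right)$; (3) for every cluster $\mathbf{C}_i$, if $v_r,v_s,v_t\in\mathbf{C}_i$, then $\widehat w_{rs}-\frac{d_r}{n}\ge \widehat w_{rt}-\widehat w_{st}$. Let $m\ge 1$ with $m+1<n$, and suppose that $v_1,\dots,v_m$ belong to the same cluster $\mathbf{C}_i$ and that $d_1\ge d_2\ge\cdots\ge d_m$. Let $\mathbf{x}_i^m\in\{0,1\}^n$ be the indicator vector of $\{v_1,\dots,v_m\}$. If $v_{m+1}$ also belongs to $\mathbf{C}_i$ and $d_{m+1}\le d_m$, and $\mathbf{x}_i^{m+1}\in\{0,1\}^n$ denotes the indicator vector of $\{v_1,\dots,v_m,v_{m+1}\}$, then $$\mathrm{MeanCut}(\mathbf{x}_i^{m+1})\le \mathrm{MeanCut}(\mathbf{x}_i^{m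}).$$
   Context: Given $n$ data points (vertices) $v_1,\dots,v_n$ in a Euclidean space, consider the fully connected (complete) undirected graph on them with edge weights $w_{ij}=\exp\left(-\frac{\|v_i-v_j\|^2}{2\sigma^2}\right)$, where $\sigma>0$ is fixed. For $i\ne j$ let $\mathbf{P}_{ij}$ be the set of all paths from $v_i$ to $v_j$; the path-based similarity is $$\widehat w_{ij}=\max_{p\in\mathbf{P}_{ij}}\ \min_{e\in p} w_e,$$ the minimum being over the edges $e$ of the path $p$. By convention $\widehat w_{ii}=w_{ii}=1$. Throughout, similarities are path-based: $\mathbf{W}=(\widehat w_{ij})\in\mathbb{R}^{n\times n}$, the degree of $v_i$ is $d_i=\sum_{j=1}^n\widehat w_{ij}$, $\mathbf{D}=\mathrm{diag}(d_1,\dots,d_n)$ and $\mathbf{L}=\mathbf{D}-\mathbf{W}$. The indicator vector of a set $S$ of vertices is the vector in $\{0,1\}^n$ whose $j$-th entry is $1$ iff $v_j\in S$. For a nonzero indicator vector $\mathbf{x}$ of a proper subset of the vertices, $$\mathrm{MeanCut}(\mathbf{x})=\frac{n}{n-\mathbf{x}^T\mathbf{x}}\cdot\frac{\mathbf{x}^T\mathbf{L}\mathbf{x}}{\mathbf{x}^T\mathbf{D}\mathbf{x}}.$$ In assumptions (1)–(3) the vertices taken from the same cluster are not required to be distinct. *)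

theory Defs
  imports "HOL-Analysis.Euclidean_Space" "HOL-Library.Disjoint_Sets" "Jordan_Normal_Form.Matrix"
begin

text \<open>
  The vertices \<open>v\<^sub>1, \<dots>, v\<^sub>n\<close> are represented by their indices, numbered from 0: the vertex set is
  \<open>{..<n}\<close>, and \<open>v a\<close> is the data point at vertex \<open>a\<close>. Different vertices may carry the same
  point.
\<close>

definition edge_weight :: "real \<Rightarrow> (nat \<Rightarrow> 'a::euclidean_space) \<Rightarrow> nat \<Rightarrow> nat \<Rightarrow> real" where
  "edge_weight \<sigma> v a b = exp (- ((norm (v a - v b))\<^sup>2 / (2 * \<sigma>\<^sup>2)))"

text \<open>
  Paths are lists of distinct vertices; the graph is complete, so any two consecutive vertices
  are adjacent. An undirected edge is given by an ordered pair of its ends, which is harmless as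
  \<^const>\<open>edge_weight\<close> is symmetric. For \<open>a \<noteq> b\<close> every path has at least one edge, and the path
  set is finite and nonempty if \<open>a, b < n\<close>, so that \<^const>\<open>Max\<close> and \<^const>\<open>Min\<close> below are genuine.
\<close>

definition paths :: "nat \<Rightarrow> nat \<Rightarrow> nat \<Rightarrow> nat list set" where
  "paths n a b = {p. p \<noteq> [] \<and> distinct p \<and> set p \<subseteq> {..<n} \<and> hd p = a \<and> last p = b}"

definition path_edges :: "nat list \<Rightarrow> (nat \<times> nat) set" where
  "path_edges p = set (zip p (tl p))"

definition path_sim :: "real \<Rightarrow> (nat \<Rightarrow> 'a::euclidean_space) \<Rightarrow> nat \<Rightarrow> nat \<Rightarrow> nat \<Rightarrow> real" where
  "path_sim \<sigma> v n a b =
    (if a = b then edge_weight \<sigma> v a a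
     else (MAX p \<in> paths n a b. MIN (c, d) \<in> path_edges p. edge_weight \<sigma> v c d))"

definition vertex_degree :: "real \<Rightarrow> (nat \<Rightarrow> 'a::euclidean_space) \<Rightarrow> nat \<Rightarrow> nat \<Rightarrow> real" where
  "vertex_degree \<sigma> v n a = (\<Sum>b<n. path_sim \<sigma> v n a b)"

definition sim_mat :: "real \<Rightarrow> (nat \<Rightarrow> 'a::euclidean_space) \<Rightarrow> nat \<Rightarrow> real mat" where
  "sim_mat \<sigma> v n = mat n n (\<lambda>(a, b). path_sim \<sigma> v n a b)"

definition degree_mat :: "real \<Rightarrow> (nat \<Rightarrow> 'a::euclidean_space) \<Rightarrow> nat \<Rightarrow> real mat" where
  "degree_mat \<sigma> v n = mat_diag n (vertex_degree \<sigma> v n)"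

definition laplacian :: "real \<Rightarrow> (nat \<Rightarrow> 'a::euclidean_space) \<Rightarrow> nat \<Rightarrow> real mat" where
  "laplacian \<sigma> v n = degree_mat \<sigma> v n - sim_mat \<sigma> v n"

definition indicator_vec :: "nat \<Rightarrow> nat set \<Rightarrow> real vec" where
  "indicator_vec n S = vec n (\<lambda>j. if j \<in> S then 1 else 0)"

definition mean_cut :: "real \<Rightarrow> (nat \<Rightarrow> 'a::euclidean_space) \<Rightarrow> nat \<Rightarrow> real vec \<Rightarrow> real" where
  "mean_cut \<sigma> v n x =
    real n / (real n - scalar_prod x x) *
    (scalar_prod x (laplacian \<sigma> v n *\<^sub>v x) / scalar_prod x (degree_mat \<sigma> v n *\<^sub>v x))"

end

theory Submission
  imports Defs
begin

text \<open>
  Let \<open>D\<close> be the sum of the degrees and \<open>W\<close> the sum of the similarities over the first \<open>m\<close>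
  vertices, let \<open>d\<close> be the degree of the new vertex and \<open>S\<close> the sum of its similarities, in
  both directions, to the old ones. With \<open>K = D - W\<close> the claim reads
  \[ K (D - d (n - m - 1)) \le (S + 1 - d) D (n - m). \]
  Assumption (2) gives \<open>W \<ge> m D / n\<close>, \<open>S \<ge> 2 D / n\<close> and \<open>d \<le> n\<close>, and monotonicity of the degrees
  gives \<open>m d \<le> D\<close>. If \<open>D \<ge> d (n - m - 1)\<close>, the upper bound \<open>K \<le> D (n - m) / n\<close> suffices. Otherwise
  a lower bound on \<open>K\<close> is needed: summing (3) over pairs of old vertices, with the new vertex in
  the middle, gives \<open>W \<le> m S - m D / n\<close>.
\<close>

lemma path_sim_self: "path_sim \<sigma> v n a a = 1"
  by (simp add: path_sim_def edge_weight_def)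

text \<open>For distinct vertices the one-edge path competes in the maximum, which is therefore at
  least a value of \<open>exp\<close>. Positive degrees, and so positive denominators in both mean
  cuts, follow from this.\<close>

lemma path_sim_pos:
  assumes "a < n" "b < n"
  shows "0 < path_sim \<sigma> v n a b"
proof (cases "a = b")
  case True
  then show ?thesis by (simp add: path_sim_self)
next
  case False
  let ?f = "\<lambda>p. MIN (c, d) \<in> path_edges p. edge_weight \<sigma> v c d"
  have fin: "finite (paths n a b)"
    by (rule finite_subset[OF _ finite_subset_distinct[of "{..<n}"]]) (auto simp: paths_def)
  have edge: "[a, b] \<in> paths n a b"
    using assms False by (simp add: paths_def)
  have "0 < ?f [a, b]"
    by (simp add: path_edges_def edge_weight_def)
  also have "\<dots> \<le> Max (?f ` paths n a b)"
    using fin edge by (intro Max_ge) auto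
  finally show ?thesis
    using False by (simp add: path_sim_def)
qed

lemma vertex_degree_pos:
  assumes "a < n"
  shows "0 < vertex_degree \<sigma> v n a"
  unfolding vertex_degree_def using assms by (intro sum_pos path_sim_pos) auto

lemma indicator_vec_scalar_prod:
  assumes "S \<subseteq> {..<n}" "dim_vec y = n"
  shows "scalar_prod (indicator_vec n S) y = (\<Sum>a\<in>S. y $ a)"
proof -
  have "scalar_prod (indicator_vec n S) y = (\<Sum>a<n. if a \<in> S then y $ a else 0)"
    using assms(2) by (auto simp: scalar_prod_def indicator_vec_def atLeast0LessThan intro!: sum.cong)
  also have "\<dots> = (\<Sum>a\<in>S. y $ a)"
    using assms(1) by (simp add: sum.inter_restrict[symmetric] Int_absorb1)
  finally show ?thesis .
qed

lemma indicator_vec_quadratic_form: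
  assumes S: "S \<subseteq> {..<n}" and M: "M \<in> carrier_mat n n"
  shows "scalar_prod (indicator_vec n S) (M *\<^sub>v indicator_vec n S) = (\<Sum>a\<in>S. \<Sum>b\<in>S. M $$ (a, b))"
proof -
  have "(M *\<^sub>v indicator_vec n S) $ a = (\<Sum>b\<in>S. M $$ (a, b))" if "a \<in> S" for a
  proof -
    have a: "a < n" using that S by auto
    have "(M *\<^sub>v indicator_vec n S) $ a = scalar_prod (indicator_vec n S) (row M a)"
      using a M by (subst comm_scalar_prod[of _ n]) (auto simp: indicator_vec_def)
    also have "\<dots> = (\<Sum>b\<in>S. row M a $ b)"
      using M by (intro indicator_vec_scalar_prod S) auto
    also have "\<dots> = (\<Sum>b\<in>S. M $$ (a, b))"
      using a M S by (intro sum.cong) auto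
    finally show ?thesis .
  qed
  then show ?thesis
    using M S by (subst indicator_vec_scalar_prod) auto
qed

text \<open>Eliminates the matrices, so that adding one vertex changes the mean cut only through
  explicit terms in sums over \<open>S\<close>.\<close>

lemma mean_cut_indicator_vec:
  fixes v :: "nat \<Rightarrow> 'a::euclidean_space"
  assumes S: "S \<subseteq> {..<n}"
  shows "mean_cut \<sigma> v n (indicator_vec n S) =
    real n / (real n - real (card S)) *
    (((\<Sum>a\<in>S. vertex_degree \<sigma> v n a) - (\<Sum>a\<in>S. \<Sum>b\<in>S. path_sim \<sigma> v n a b)) /
      (\<Sum>a\<in>S. vertex_degree \<sigma> v n a))"
proof -
  have fin: "finite S" using S finite_subset by blast
  have "scalar_prod (indicator_vec n S) (indicator_vec n S) = (\<Sum>a\<in>S. indicator_vec n S $ a)"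
    by (intro indicator_vec_scalar_prod S) (simp add: indicator_vec_def)
  also have "\<dots> = (\<Sum>a\<in>S. 1)"
    using S by (intro sum.cong) (auto simp: indicator_vec_def)
  finally have norm: "scalar_prod (indicator_vec n S) (indicator_vec n S) = real (card S)"
    by simp
  have diag: "(\<Sum>a\<in>S. \<Sum>b\<in>S. degree_mat \<sigma> v n $$ (a, b)) = (\<Sum>a\<in>S. vertex_degree \<sigma> v n a)"
  proof (intro sum.cong refl)
    fix a assume a: "a \<in> S"
    have "(\<Sum>b\<in>S. degree_mat \<sigma> v n $$ (a, b)) =
        (\<Sum>b\<in>S. if a = b then vertex_degree \<sigma> v n b else 0)"
      using a S by (intro sum.cong) (auto simp: degree_mat_def mat_diag_def subset_iff)
    then show "(\<Sum>b\<in>S. degree_mat \<sigma> v n $$ (a, b)) = vertex_degree \<sigma> v n a"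
      using a fin by simp
  qed
  have D: "scalar_prod (indicator_vec n S) (degree_mat \<sigma> v n *\<^sub>v indicator_vec n S) =
      (\<Sum>a\<in>S. vertex_degree \<sigma> v n a)"
    by (subst indicator_vec_quadratic_form[OF S]) (simp_all only: diag, simp add: degree_mat_def)
  have "(\<Sum>a\<in>S. \<Sum>b\<in>S. laplacian \<sigma> v n $$ (a, b)) =
      (\<Sum>a\<in>S. \<Sum>b\<in>S. degree_mat \<sigma> v n $$ (a, b) - path_sim \<sigma> v n a b)"
    using S by (intro sum.cong refl) (auto simp: laplacian_def sim_mat_def subset_iff)
  then have "(\<Sum>a\<in>S. \<Sum>b\<in>S. laplacian \<sigma> v n $$ (a, b)) =
      (\<Sum>a\<in>S. vertex_degree \<sigma> v n a) - (\<Sum>a\<in>S. \<Sum>b\<in>S. path_sim \<sigma> v n a b)"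
    by (simp add: sum_subtractf diag)
  then have L: "scalar_prod (indicator_vec n S) (laplacian \<sigma> v n *\<^sub>v indicator_vec n S) =
      (\<Sum>a\<in>S. vertex_degree \<sigma> v n a) - (\<Sum>a\<in>S. \<Sum>b\<in>S. path_sim \<sigma> v n a b)"
    by (subst indicator_vec_quadratic_form[OF S]) (auto simp: laplacian_def sim_mat_def)
  show ?thesis
    by (simp add: mean_cut_def norm D L)
qed

text \<open>This is the comparison of the two mean cuts with denominators cleared and the common
  factor \<open>n\<close> dropped.\<close>

lemma mean_cut_step_inequality:
  fixes n m D W S d :: real
  assumes m: "0 \<le> m" "m + 1 < n"
    and d: "d \<le> n" and D: "0 < D" "m * d \<le> D"
    and W_lower: "m * D \<le> n * W"
    and S_lower: "2 * D \<le> n * S"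
    and W_upper: "n * W \<le> m * (n * S) - m * D"
  shows "((D + d) - (W + S + 1)) * (D * (n - m)) \<le> (D - W) * ((D + d) * (n - m - 1))"
proof -
  \<comment> \<open>\<open>U\<close> is the slack in \<open>S_lower\<close>; the sign of
    \<open>g\<close>, the coefficient of \<open>D - W\<close> after rearranging, decides which bound
    on \<open>D - W\<close> is used.\<close>
  define U where "U = n * S - 2 * D"
  define g where "g = d * (n - m - 1) - D"
  have U: "0 \<le> U" using S_lower by (simp add: U_def)
  have n: "0 < n" and nm: "0 \<le> D * (n - m)" using m D by auto
  \<comment> \<open>The last factor is the sum of \<open>D - m * d\<close> and \<open>n - d\<close>.
    It equals \<open>g - (n * d - 2 * D - n)\<close>, which is how it enters both cases.\<close>
  have gap: "0 \<le> D * (n - m) * (D - d * (m + 1) + n)"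
    using nm d D by (intro mult_nonneg_nonneg) (auto simp: algebra_simps)
  \<comment> \<open>The goal multiplied by \<open>n\<close>, with all terms in \<open>D - W\<close>
    collected on the right and \<open>n * S\<close> replaced by \<open>2 * D + U\<close>.\<close>
  have "D * (n - m) * (n * d - 2 * D - U - n) \<le> n * (D - W) * g"
  proof (cases "0 \<le> g")
    case True
    \<comment> \<open>In terms of \<open>U\<close>, \<open>W_upper\<close> says
      \<open>n * (D - W) \<ge> D * (n - m) - m * U\<close>. Once this is inserted, the difference of
      the two sides is the \<open>gap\<close> product plus \<open>U\<close> times
      \<open>n * D - m * d * (n - m - 1)\<close>.\<close>
    have "m * d * (n - m - 1) \<le> D * (n - m - 1)"
      using D m by (intro mult_right_mono) auto
    also have "\<dots> \<le> D * n" using D m by (intro mult_left_mono) auto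
    finally have "0 \<le> U * (n * D - m * d * (n - m - 1))"
      using U by (intro mult_nonneg_nonneg) (auto simp: algebra_simps)
    then have "D * (n - m) * (n * d - 2 * D - U - n) \<le> (D * (n - m) - m * U) * g"
      using gap by (simp add: g_def algebra_simps)
    also have "\<dots> \<le> n * (D - W) * g"
      using W_upper True by (intro mult_right_mono) (auto simp: U_def algebra_simps)
    finally show ?thesis .
  next
    case False
    \<comment> \<open>As \<open>g\<close> is negative, the upper bound \<open>D * (n - m)\<close> on
      \<open>n * (D - W)\<close> gives the lower bound on the product.\<close>
    have "0 \<le> D * (n - m) * U" using nm U by simp
    then have "D * (n - m) * (n * d - 2 * D - U - n) \<le> D * (n - m) * g"
      using gap by (simp add: g_def algebra_simps)
    also have "\<dots> \<le> n * (D - W) * g"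
      using W_lower False by (intro mult_right_mono_neg) (auto simp: algebra_simps)
    finally show ?thesis .
  qed
  then have "n * (((D + d) - (W + S + 1)) * (D * (n - m)))
      \<le> n * ((D - W) * ((D + d) * (n - m - 1)))"
    by (simp add: U_def g_def algebra_simps)
  then show ?thesis using n by simp
qed

theorem mainTheorem1:
  fixes v :: "nat \<Rightarrow> 'a::euclidean_space"
    and \<sigma> :: real
    and n k m i :: nat
    and C :: "nat \<Rightarrow> nat set"
  assumes sigma: "\<sigma> > 0"
    and clusters: "partition_on {..<n} (C ` {..<k})" "inj_on C {..<k}"
    and assumption1: "\<And>a b r s t. a < k \<Longrightarrow> b < k \<Longrightarrow> a \<noteq> b \<Longrightarrow>
          r \<in> C a \<Longrightarrow> s \<in> C a \<Longrightarrow> t \<in> C b \<Longrightarrow>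
          path_sim \<sigma> v n r s \<ge> max (path_sim \<sigma> v n r t) (path_sim \<sigma> v n s t)"
    and assumption2: "\<And>a r s. a < k \<Longrightarrow> r \<in> C a \<Longrightarrow> s \<in> C a \<Longrightarrow>
          path_sim \<sigma> v n r s \<ge> max (vertex_degree \<sigma> v n r / real n) (vertex_degree \<sigma> v n s / real n)"
    and assumption3: "\<And>a r s t. a < k \<Longrightarrow> r \<in> C a \<Longrightarrow> s \<in> C a \<Longrightarrow> t \<in> C a \<Longrightarrow>
          path_sim \<sigma> v n r s - vertex_degree \<sigma> v n r / real n \<ge> path_sim \<sigma> v n r t - path_sim \<sigma> v n s t"
    and m: "m \<ge> 1" "m + 1 < n"
    and i: "i < k"
    and first_m: "{..<m} \<subseteq> C i"
    and decreasing: "\<And>a b. a \<le> b \<Longrightarrow> b < m \<Longrightarrow> vertex_degree \<sigma> v n b \<le> vertex_degree \<sigma> v n a"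
    and next_vertex: "m \<in> C i" "vertex_degree \<sigma> v n m \<le> vertex_degree \<sigma> v n (m - 1)"
  shows "mean_cut \<sigma> v n (indicator_vec n {..<m + 1}) \<le> mean_cut \<sigma> v n (indicator_vec n {..<m})"
proof -
  let ?w = "path_sim \<sigma> v n" and ?d = "vertex_degree \<sigma> v n"
  define D where "D = (\<Sum>a<m. ?d a)"
  define W where "W = (\<Sum>a<m. \<Sum>b<m. ?w a b)"
  define S where "S = (\<Sum>a<m. ?w a m + ?w m a)"
  have n: "0 < real n" using m by simp
  have C: "a \<in> C i" if "a < m" for a using first_m that by auto
  have le_sim: "?d r \<le> real n * ?w r s" "?d s \<le> real n * ?w r s" if "r \<in> C i" "s \<in> C i" for r s
    using assumption2[OF i that] n by (auto simp: field_simps)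
  \<comment> \<open>Assumption (3) solved for the similarity of \<open>r\<close> and
    \<open>t\<close>, with \<open>s\<close> as the intermediate vertex.\<close>
  have triangle: "real n * ?w r t \<le> real n * ?w r s + real n * ?w s t - ?d r"
    if "r \<in> C i" "s \<in> C i" "t \<in> C i" for r s t
  proof -
    have "real n * (?w r t - ?w s t) \<le> real n * (?w r s - ?d r / real n)"
      using assumption3[OF i that] n by (intro mult_left_mono) auto
    then show ?thesis using n by (simp add: algebra_simps)
  qed
  have d_pos: "0 < ?d a" if "a \<le> m" for a
    using that m by (intro vertex_degree_pos) auto
  have D_pos: "0 < D"
    unfolding D_def using m d_pos by (intro sum_pos) (auto simp: lessThan_empty_iff)
  \<comment> \<open>Assumption (2) with both vertices equal to \<open>m\<close>, whose
    self-similarity is 1.\<close>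
  have d_le: "?d m \<le> real n"
    using le_sim(1)[OF next_vertex(1) next_vertex(1)] by (simp add: path_sim_self)
  \<comment> \<open>Numbering starts at 0: \<open>m\<close> is the new vertex and
    \<open>m - 1\<close> the last old one.\<close>
  have "?d m \<le> ?d a" if "a < m" for a
    using decreasing[of a "m - 1"] next_vertex(2) that by force
  then have mean: "real m * ?d m \<le> D"
    unfolding D_def using sum_bounded_below[of "{..<m}" "?d m" ?d] by simp
  have "(\<Sum>a<m. \<Sum>b<m. ?d a) \<le> (\<Sum>a<m. \<Sum>b<m. real n * ?w a b)"
    using le_sim(1) C by (intro sum_mono) auto
  then have W_lower: "real m * D \<le> real n * W"
    by (simp add: D_def W_def sum_distrib_left)
  have "(\<Sum>a<m. 2 * ?d a) \<le> (\<Sum>a<m. real n * ?w a m + real n * ?w m a)"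
  proof (rule sum_mono)
    fix a assume "a \<in> {..<m}"
    then show "2 * ?d a \<le> real n * ?w a m + real n * ?w m a"
      using le_sim(1)[of a m] le_sim(2)[of m a] C[of a] next_vertex(1) by auto
  qed
  then have S_lower: "2 * D \<le> real n * S"
    by (simp add: D_def S_def sum_distrib_left distrib_left)
  have "real n * W = (\<Sum>a<m. \<Sum>b<m. real n * ?w a b)"
    by (simp add: W_def sum_distrib_left)
  \<comment> \<open>The pairs with \<open>a = b\<close> are covered too, since assumption (3) allows
    equal vertices.\<close>
  also have "\<dots> \<le> (\<Sum>a<m. \<Sum>b<m. real n * ?w a m + real n * ?w m b - ?d a)"
    using triangle C next_vertex(1) by (intro sum_mono) auto
  also have "\<dots> = real m * (real n * S) - real m * D"
    by (simp add: D_def S_def sum.distrib sum_subtractf sum_distrib_left[symmetric] algebra_simps)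
  finally have W_upper: "real n * W \<le> real m * (real n * S) - real m * D" .
  have old: "mean_cut \<sigma> v n (indicator_vec n {..<m}) =
      real n / (real n - real m) * ((D - W) / D)"
    using m by (subst mean_cut_indicator_vec) (auto simp: D_def W_def)
  \<comment> \<open>The new row and column contribute \<open>S\<close>, and their common entry
    \<open>?w m m\<close> contributes 1.\<close>
  have "(\<Sum>a<m + 1. \<Sum>b<m + 1. ?w a b) = W + S + 1"
    by (simp add: W_def S_def sum.distrib path_sim_self)
  then have new: "mean_cut \<sigma> v n (indicator_vec n {..<m + 1}) =
      real n / (real n - real m - 1) * (((D + ?d m) - (W + S + 1)) / (D + ?d m))"
    using m by (subst mean_cut_indicator_vec) (auto simp: D_def algebra_simps)
  have main: "((D + ?d m) - (W + S + 1)) * (D * (real n - real m))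
      \<le> (D - W) * ((D + ?d m) * (real n - real m - 1))"
    using m by (intro mean_cut_step_inequality d_le D_pos mean W_lower S_lower W_upper) auto
  have denoms: "0 < D * (real n - real m)" "0 < (D + ?d m) * (real n - real m - 1)"
    using m D_pos d_pos[of m] by (auto intro!: mult_pos_pos)
  have "((D + ?d m) - (W + S + 1)) / ((D + ?d m) * (real n - real m - 1))
      \<le> (D - W) / (D * (real n - real m))"
    using main denoms by (simp only: divide_le_eq pos_le_divide_eq times_divide_eq_left if_True)
  from mult_left_mono[OF this less_imp_le[OF n]] show ?thesis
    unfolding old new by (simp add: mult.commute)
qed

end
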